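(* Let $p>1$, and let $\phi:(-\infty,0]\to(0,\infty)$ be a bounded continuous function (so $\phi(s)>0$ for all $s\le 0$). For any $\alpha>0$ and $\beta>0$, let $u(t)$ be the solution of the distributed delay differential equation $$\dot u(t)=\left(\int_{-\infty}^{t}\alpha e^{-\beta(t-s)}u(s)\,ds\right)^{p}\quad (t>0),\qquad u(s)=\phi(s)\quad (s\le 0).$$ Then there exists a finite time $T>0$ such that $u$ blows up at $t=T$. In addition, there exist positive constants $A_1$ and $A_2$ such that $$u(t)=A_1\,(T-t)^{-\frac{p+1}{p-1}}(1+o(1))\quad\text{as } t\to T^-$$ and $$\dot u(t)=A_2\,(T-t)^{-\frac{2p}{p-1}}(1+o(1))\quad\text{as } t\to T^-.$$
   Context: Here $\dot u=du/dt$. A solution on $[0,T)$ with initial function $\phi$ is a continuous function $u:(-\infty,T)\to\mathbb{R}$ with $u=\phi$ on $(-\infty,0]$ that satisfies the equation for $t\in(0,T)$. The solution $u$ is said to blow up at the finite time $T\in(0,\infty)$ (the blow-up time) if it exists on $[0,T)$ and $\lim_{t\to T^-}u(t)=+\infty$. *)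

theory Defs
  imports "HOL-Analysis.Analysis" "HOL-Library.Landau_Symbols"
begin

text \<open>
  A function on \<open>(-\<infinity>,T)\<close> is represented by a total function whose values outside \<open>{..<T}\<close> are
  irrelevant.  Along a solution with bounded continuous history the integrand is Lebesgue
  integrable on \<open>{..t}\<close> for each \<open>t < T\<close>.  Moreover, \<open>powr\<close> is nonnegative for every base, so a
  solution with positive history is nondecreasing on \<open>[0,T)\<close> and the integral is positive:
  \<open>powr\<close> is only ever applied to a positive base.
\<close>

definition delay_solution ::
  "real \<Rightarrow> real \<Rightarrow> real \<Rightarrow> (real \<Rightarrow> real) \<Rightarrow> real \<Rightarrow> (real \<Rightarrow> real) \<Rightarrow> bool" where
  "delay_solution p \<alpha> \<beta> \<phi> T u \<longleftrightarrow>
     0 < T \<and>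
     continuous_on {..<T} u \<and>
     (\<forall>s\<le>0. u s = \<phi> s) \<and>
     (\<forall>t. 0 < t \<and> t < T \<longrightarrow>
        (u has_real_derivative (LBINT s:{..t}. \<alpha> * exp (- \<beta> * (t - s)) * u s) powr p) (at t))"

text \<open>
  The solution of the initial value problem, in the sense of its uniqueness and maximality: every
  solution, on whatever interval \<open>[0,T')\<close>, is a restriction of \<open>u\<close>.
\<close>

definition the_delay_solution ::
  "real \<Rightarrow> real \<Rightarrow> real \<Rightarrow> (real \<Rightarrow> real) \<Rightarrow> real \<Rightarrow> (real \<Rightarrow> real) \<Rightarrow> bool" where
  "the_delay_solution p \<alpha> \<beta> \<phi> T u \<longleftrightarrow>
     delay_solution p \<alpha> \<beta> \<phi> T u \<and>
     (\<forall>T' v. delay_solution p \<alpha> \<beta> \<phi> T' v \<longrightarrow> T' \<le> T \<and> (\<forall>t<T'. v t = u t))"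

definition blows_up_at :: "(real \<Rightarrow> real) \<Rightarrow> real \<Rightarrow> bool" where
  "blows_up_at u T \<longleftrightarrow> filterlim u at_top (at_left T)"

end

theory Submission
  imports Defs
begin

text \<open>
  With \<open>w\<close> the delay integral, the equation is the cooperative planar system \<open>u' = w powr p\<close>,
  \<open>w' = \<alpha> * u - \<beta> * w\<close>. Its integral form is monotone in \<open>u\<close>, so the Picard iterates started at the
  constant \<open>u(0)\<close> increase to a minimal solution, which exists exactly as long as the iterates stay
  bounded and which lies below every other solution; a Gronwall estimate gives uniqueness.

  Put \<open>v = w'\<close>. Eventually \<open>v > 0\<close>, and \<open>w\<close> grows without bound. Taking \<open>w\<close> as the independent
  variable, L'Hospital's rule gives \<open>v\<^sup>2 / w powr (p + 1) \<rightarrow> 2 * \<alpha> / (p + 1)\<close>, that is,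
  \<open>w' \<sim> k * w powr ((p + 1) / 2)\<close>. Since \<open>(p + 1) / 2 > 1\<close>, this excludes a global solution, and
  integrating it up to the blow-up time gives \<open>w \<sim> c * (T - t) powr (- (2 / (p - 1)))\<close>. The rates of
  \<open>u' = w powr p\<close> and of \<open>u = (v + \<beta> * w) / \<alpha>\<close> follow.
\<close>

section \<open>Growth of trajectories of the planar system\<close>

lemma linear_growth:
  fixes f :: "real \<Rightarrow> real"
  assumes "a \<le> b" and "\<And>t. a \<le> t \<Longrightarrow> t \<le> b \<Longrightarrow> (f has_real_derivative f' t) (at t)"
    and "\<And>t. a \<le> t \<Longrightarrow> t \<le> b \<Longrightarrow> m \<le> f' t"
  shows "f a + m * (b - a) \<le> f b"
proof -
  have "f a - m * a \<le> f b - m * b"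
    by (rule DERIV_nonneg_imp_nondecreasing[OF \<open>a \<le> b\<close>])
      (use assms in \<open>auto intro!: exI derivative_eq_intros\<close>)
  then show ?thesis by (simp add: algebra_simps)
qed

text \<open>\<open>J\<close> is order-convex, so the segment between two of its times stays inside.
  The instances are \<open>{0<..}\<close>, to rule out a global trajectory, and
  \<open>{0<..<T}\<close>, to find the rate.\<close>

locale planar_flow =
  fixes p \<alpha> \<beta> :: real and u w :: "real \<Rightarrow> real" and J :: "real set"
  assumes p: "p > 1" and \<alpha>: "\<alpha> > 0" and \<beta>: "\<beta> > 0"
    and J: "\<And>a b t. a \<in> J \<Longrightarrow> b \<in> J \<Longrightarrow> a \<le> t \<Longrightarrow> t \<le> b \<Longrightarrow> t \<in> J"
    and u_deriv: "\<And>t. t \<in> J \<Longrightarrow> (u has_real_derivative w t powr p) (at t)"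
    and w_deriv: "\<And>t. t \<in> J \<Longrightarrow> (w has_real_derivative \<alpha> * u t - \<beta> * w t) (at t)"
    and w_pos: "\<And>t. t \<in> J \<Longrightarrow> w t > 0"
begin

definition v :: "real \<Rightarrow> real" where
  "v t = \<alpha> * u t - \<beta> * w t"

lemma v_deriv: "t \<in> J \<Longrightarrow> (v has_real_derivative \<alpha> * w t powr p - \<beta> * v t) (at t)"
  unfolding v_def by (auto intro!: derivative_eq_intros u_deriv w_deriv)

lemma w_deriv': "t \<in> J \<Longrightarrow> (w has_real_derivative v t) (at t)"
  using w_deriv by (simp add: v_def)

lemma w_powr_deriv:
  "t \<in> J \<Longrightarrow> ((\<lambda>t. w t powr r) has_real_derivative r * w t powr (r - 1) * v t) (at t)"
  using DERIV_fun_powr[OF w_deriv', of t r] w_pos[of t] by simp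

text \<open>If \<open>v\<close> were nowhere positive, \<open>w\<close> would stay below
  \<open>w t0\<close> after \<open>t0\<close>, and \<open>\<alpha> * u \<le> \<beta> * w\<close>
  would bound \<open>u\<close>.\<close>

lemma ex_v_pos:
  assumes "t0 \<in> J" and "\<And>M. \<exists>t\<in>J. t0 \<le> t \<and> u t > M"
  shows "\<exists>t\<in>J. v t > 0"
proof (rule ccontr)
  assume "\<not> ?thesis"
  then have neg: "v t \<le> 0" if "t \<in> J" for t using that by force
  obtain t where t: "t \<in> J" "t0 \<le> t" "u t > \<beta> * w t0 / \<alpha>" using assms(2) by blast
  have "w t \<le> w t0"
    by (rule DERIV_nonpos_imp_nonincreasing[OF t(2)]) (use J[OF assms(1) t(1)] neg w_deriv' in blast)
  then have "\<beta> * w t \<le> \<beta> * w t0" using \<beta> by simp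
  then have "v t > 0" using t(3) \<alpha> by (simp add: v_def field_simps)
  with neg[OF t(1)] show False by simp
qed

text \<open>With the integrating factor \<open>exp (\<beta> * t)\<close> the damping disappears from
  the equation for \<open>v\<close>, and only the nonnegative source
  \<open>\<alpha> * w powr p\<close> remains.\<close>

lemma v_pos:
  assumes "t1 \<in> J" "v t1 > 0" "t \<in> J" "t1 \<le> t"
  shows "v t > 0"
proof -
  have "v t1 * exp (\<beta> * t1) \<le> v t * exp (\<beta> * t)"
  proof (rule DERIV_nonneg_imp_nondecreasing[OF assms(4)])
    fix s assume "t1 \<le> s" "s \<le> t"
    then have s: "s \<in> J" using J[OF assms(1,3)] by auto
    have "((\<lambda>t. v t * exp (\<beta> * t)) has_real_derivative \<alpha> * w s powr p * exp (\<beta> * s)) (at s)"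
      by (rule derivative_eq_intros v_deriv[OF s] refl | simp add: algebra_simps)+
    with \<alpha> show "\<exists>y. ((\<lambda>t. v t * exp (\<beta> * t)) has_real_derivative y) (at s) \<and> 0 \<le> y"
      by (intro exI conjI) auto
  qed
  moreover have "v t1 * exp (\<beta> * t1) > 0" using assms by simp
  ultimately have "v t * exp (\<beta> * t) > 0" by linarith
  then show ?thesis by (simp add: zero_less_mult_iff)
qed

lemma w_mono:
  assumes "t1 \<in> J" "v t1 > 0" "t \<in> J" "t1 \<le> s" "s \<le> t"
  shows "w s \<le> w t"
  by (rule DERIV_nonneg_imp_nondecreasing[OF assms(5)])
    (use assms J[OF assms(1,3)] v_pos w_deriv' in \<open>meson less_imp_le order_trans\<close>)

text \<open>The damping term makes the energy \<open>v\<^sup>2 / 2 - \<alpha> w powr (p + 1) / (p + 1)\<close> decrease.\<close>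

lemma v_squared_le:
  assumes "t1 \<in> J" "v t1 > 0" "t \<in> J" "t1 \<le> t"
  shows "(v t)\<^sup>2 \<le> (v t1)\<^sup>2 + 2 * \<alpha> / (p + 1) * w t powr (p + 1)"
proof -
  have "(v t)\<^sup>2 - 2 * \<alpha> / (p + 1) * w t powr (p + 1)
      \<le> (v t1)\<^sup>2 - 2 * \<alpha> / (p + 1) * w t1 powr (p + 1)"
  proof (rule DERIV_nonpos_imp_nonincreasing[OF assms(4)])
    fix s assume "t1 \<le> s" "s \<le> t"
    then have s: "s \<in> J" using J[OF assms(1,3)] by auto
    have "((\<lambda>t. (v t)\<^sup>2 - 2 * \<alpha> / (p + 1) * w t powr (p + 1)) has_real_derivative
        2 * v s * (\<alpha> * w s powr p - \<beta> * v s) - 2 * \<alpha> / (p + 1) * ((p + 1) * w s powr p * v s)) (at s)"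
      using DERIV_diff[OF DERIV_power[OF v_deriv[OF s], of 2]
          DERIV_cmult[OF w_powr_deriv[OF s, of "p + 1"], of "2 * \<alpha> / (p + 1)"]]
      by (simp add: algebra_simps)
    moreover have "2 * v s * (\<alpha> * w s powr p - \<beta> * v s) - 2 * \<alpha> / (p + 1) * ((p + 1) * w s powr p * v s)
        = - 2 * \<beta> * (v s)\<^sup>2"
      using p by (simp add: field_simps power2_eq_square)
    ultimately show "\<exists>y. ((\<lambda>t. (v t)\<^sup>2 - 2 * \<alpha> / (p + 1) * w t powr (p + 1)) has_real_derivative y) (at s) \<and> y \<le> 0"
      using \<beta> by force
  qed
  \<comment> \<open>The initial potential term enters the bound with a minus sign and is
    dropped.\<close>
  moreover have "2 * \<alpha> / (p + 1) * w t1 powr (p + 1) \<ge> 0" using \<alpha> p by simp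
  ultimately show ?thesis by linarith
qed

text \<open>
  Along the trajectory \<open>d(v\<^sup>2) / dw = 2 * (\<alpha> * w powr p - \<beta> * v)\<close>, and the energy bound makes
  \<open>v\<close> negligible against \<open>w powr p\<close>, so L'Hospital's rule applies to \<open>v\<^sup>2 / w powr (p + 1)\<close>.
\<close>

lemma ratio_limit:
  assumes F: "F = at_top \<or> F = at_left T"
    and t1: "t1 \<in> J" "v t1 > 0" and ev: "eventually (\<lambda>t. t \<in> J \<and> t1 \<le> t) F"
    and lim: "filterlim w at_top F"
  shows "((\<lambda>t. v t / w t powr ((p + 1) / 2)) \<longlongrightarrow> sqrt (2 * \<alpha> / (p + 1))) F"
proof -
  \<comment> \<open>This is the square of \<open>v / w powr p\<close>. Dividing the energy bound by
    \<open>w powr (2 * p)\<close> leaves the exponents \<open>- 2 * p\<close> and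
    \<open>1 - p\<close>, both negative.\<close>
  have "((\<lambda>t. (v t)\<^sup>2 * w t powr (- 2 * p)) \<longlongrightarrow> 0) F"
  proof (rule tendsto_sandwich)
    show "eventually (\<lambda>t. 0 \<le> (v t)\<^sup>2 * w t powr (- 2 * p)) F" by simp
    show "eventually (\<lambda>t. (v t)\<^sup>2 * w t powr (- 2 * p) \<le>
        (v t1)\<^sup>2 * w t powr (- 2 * p) + 2 * \<alpha> / (p + 1) * w t powr (1 - p)) F"
      using ev
    proof eventually_elim
      case (elim t)
      have "(v t)\<^sup>2 * w t powr (- 2 * p)
          \<le> ((v t1)\<^sup>2 + 2 * \<alpha> / (p + 1) * w t powr (p + 1)) * w t powr (- 2 * p)"
        using v_squared_le[OF t1, of t] elim by (intro mult_right_mono) auto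
      also have "w t powr (1 - p) = w t powr (p + 1) * w t powr (- 2 * p)"
        by (simp flip: powr_add)
      ultimately show ?case by (simp add: algebra_simps)
    qed
    have "((\<lambda>t. (v t1)\<^sup>2 * w t powr (- 2 * p) + 2 * \<alpha> / (p + 1) * w t powr (1 - p)) \<longlongrightarrow>
        (v t1)\<^sup>2 * 0 + 2 * \<alpha> / (p + 1) * 0) F"
      using p by (intro tendsto_intros tendsto_neg_powr lim) auto
    then show "((\<lambda>t. (v t1)\<^sup>2 * w t powr (- 2 * p) + 2 * \<alpha> / (p + 1) * w t powr (1 - p)) \<longlongrightarrow> 0) F"
      by simp
  qed auto
  then have "((\<lambda>t. sqrt ((v t)\<^sup>2 * w t powr (- 2 * p))) \<longlongrightarrow> sqrt 0) F"
    by (rule tendsto_real_sqrt)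
  moreover have "eventually (\<lambda>t. sqrt ((v t)\<^sup>2 * w t powr (- 2 * p)) = v t * w t powr (- p)) F"
    using ev
  proof eventually_elim
    case (elim t)
    have "(v t)\<^sup>2 * w t powr (- 2 * p) = (v t * w t powr (- p))\<^sup>2"
      by (simp add: power_mult_distrib power2_eq_square flip: powr_add)
    moreover have "v t * w t powr (- p) \<ge> 0" using v_pos[OF t1, of t] elim by simp
    ultimately show ?case by simp
  qed
  ultimately have small: "((\<lambda>t. v t * w t powr (- p)) \<longlongrightarrow> 0) F"
    using Lim_transform_eventually by fastforce
  \<comment> \<open>These are the time derivatives of \<open>v\<^sup>2\<close> and
    \<open>w powr (p + 1)\<close>. The factor \<open>v\<close> cancels in their quotient, which
    becomes \<open>2 / (p + 1) * (\<alpha> - \<beta> * v / w powr p)\<close>.\<close>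
  let ?f' = "\<lambda>t. 2 * v t * (\<alpha> * w t powr p - \<beta> * v t)" 
  let ?g' = "\<lambda>t. (p + 1) * w t powr p * v t"
  have g: "filterlim (\<lambda>t. w t powr (p + 1)) at_top F"
    using p by (intro filterlim_compose[OF _ lim]) real_asymp
  have g': "eventually (\<lambda>t. ?g' t \<noteq> 0) F"
    using ev
  proof eventually_elim
    case (elim t)
    then show ?case using v_pos[OF t1, of t] w_pos[of t] p by simp
  qed
  have df: "eventually (\<lambda>t. ((\<lambda>t. (v t)\<^sup>2) has_real_derivative ?f' t) (at t)) F"
    using ev by eventually_elim (auto intro!: derivative_eq_intros v_deriv)
  have dg: "eventually (\<lambda>t. ((\<lambda>t. w t powr (p + 1)) has_real_derivative ?g' t) (at t)) F"
    using ev
  proof eventually_elim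
    case (elim t)
    then show ?case using w_powr_deriv[of t "p + 1"] by simp
  qed
  have "((\<lambda>t. 2 / (p + 1) * (\<alpha> - \<beta> * (v t * w t powr (- p)))) \<longlongrightarrow> 2 / (p + 1) * (\<alpha> - \<beta> * 0)) F"
    by (intro tendsto_intros small)
  moreover have "eventually (\<lambda>t. 2 / (p + 1) * (\<alpha> - \<beta> * (v t * w t powr (- p))) = ?f' t / ?g' t) F"
    using ev
  proof eventually_elim
    case (elim t)
    then have "v t > 0" "w t powr p > 0" using v_pos[OF t1, of t] w_pos[of t] by auto
    moreover have "p + 1 > 0" using p by simp
    ultimately have "2 / (p + 1) * (\<alpha> - \<beta> * (v t / w t powr p)) = ?f' t / ?g' t"
      by (simp add: divide_simps)
    then show ?case by (simp add: powr_minus divide_inverse)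
  qed
  ultimately have "((\<lambda>t. ?f' t / ?g' t) \<longlongrightarrow> 2 / (p + 1) * (\<alpha> - \<beta> * 0)) F"
    by (rule Lim_transform_eventually)
  then have q: "((\<lambda>t. ?f' t / ?g' t) \<longlongrightarrow> 2 * \<alpha> / (p + 1)) F"
    by simp
  have "((\<lambda>t. (v t)\<^sup>2 / w t powr (p + 1)) \<longlongrightarrow> 2 * \<alpha> / (p + 1)) F"
    using F
  proof
    assume "F = at_top"
    then show ?thesis
      using lhospital_at_top_at_top[of _ ?g' _ ?f'] g g' df dg q by simp
  next
    assume "F = at_left T"
    then show ?thesis
      using lhopital_left_at_top[of _ _ ?g' _ ?f'] g g' df dg q by simp
  qed
  then have "((\<lambda>t. sqrt ((v t)\<^sup>2 / w t powr (p + 1))) \<longlongrightarrow> sqrt (2 * \<alpha> / (p + 1))) F"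
    by (rule tendsto_real_sqrt)
  moreover have "eventually (\<lambda>t. sqrt ((v t)\<^sup>2 / w t powr (p + 1)) = v t / w t powr ((p + 1) / 2)) F"
    using ev
  proof eventually_elim
    case (elim t)
    have "w t powr (p + 1) = (w t powr ((p + 1) / 2))\<^sup>2"
      by (simp add: power2_eq_square flip: powr_add)
    then have "(v t)\<^sup>2 / w t powr (p + 1) = (v t / w t powr ((p + 1) / 2))\<^sup>2"
      by (simp add: power_divide)
    then have "sqrt ((v t)\<^sup>2 / w t powr (p + 1)) = \<bar>v t / w t powr ((p + 1) / 2)\<bar>"
      by (simp only: real_sqrt_abs)
    then show ?case using v_pos[OF t1, of t] elim by simp
  qed
  ultimately show ?thesis by (simp cong: tendsto_cong)
qed

end

text \<open>First \<open>v\<close> becomes positive, then it stays bounded away from 0, so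
  \<open>w\<close> tends to infinity. The limit of \<open>v / w powr ((p + 1) / 2)\<close> then
  makes \<open>w powr (- ((p - 1) / 2))\<close> decrease at least linearly, so it would reach 0 in
  finite time.\<close>

lemma planar_flow_no_global:
  assumes "planar_flow p \<alpha> \<beta> u w {0<..}" and u_pos: "\<And>t. t > 0 \<Longrightarrow> u t > 0"
  shows False
proof -
  interpret planar_flow p \<alpha> \<beta> u w "{0<..}" by fact
  have "\<exists>t\<in>{0<..}. v t > 0"
  proof (rule ccontr)
    assume "\<not> ?thesis"
    then have neg: "\<alpha> * u t \<le> \<beta> * w t" if "t > 0" for t using that by (force simp: v_def)
    \<comment> \<open>If \<open>v\<close> is never positive, then \<open>w \<ge> \<alpha> / \<beta>
      * u \<ge> \<alpha> / \<beta> * u 1\<close> from time 1 on, so \<open>c\<close> bounds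
      \<open>u'\<close> from below and \<open>u\<close> is unbounded.\<close>
    define c where "c = (\<alpha> / \<beta> * u 1) powr p"
    have c: "c > 0" using \<alpha> \<beta> u_pos[of 1] by (simp add: c_def)
    have u1: "u 1 \<le> u t" if "1 \<le> t" for t
      using linear_growth[OF that u_deriv, of 0] by simp
    have grow: "u 1 + c * (t - 1) \<le> u t" if "1 \<le> t" for t
    proof (rule linear_growth[OF that u_deriv])
      fix s :: real assume s: "1 \<le> s"
      have "\<alpha> * u 1 \<le> \<alpha> * u s" using u1[OF s] \<alpha> by simp
      also have "\<dots> \<le> \<beta> * w s" using neg[of s] s by simp
      finally show "c \<le> w s powr p" unfolding c_def
        using p \<alpha> \<beta> u_pos[of 1] by (intro powr_mono2) (auto simp: field_simps)
    qed auto
    have "\<exists>t\<in>{0<..}. 1 \<le> t \<and> u t > M" for M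
    proof -
      define t where "t = 1 + \<bar>M\<bar> / c"
      have "1 \<le> t" using c by (simp add: t_def)
      with grow[OF this] c have "u 1 + \<bar>M\<bar> \<le> u t" by (simp add: t_def)
      then show ?thesis using \<open>1 \<le> t\<close> u_pos[of 1] by (intro bexI[of _ t]) auto
    qed
    from ex_v_pos[OF _ this] \<open>\<not> ?thesis\<close> show False by simp
  qed
  then obtain t1 where t1: "t1 > 0" "v t1 > 0" by auto
  \<comment> \<open>\<open>d\<close> is the equilibrium of
    \<open>v' = \<alpha> * w t1 powr p - \<beta> * v\<close>. As \<open>w\<close> does not fall
    below \<open>w t1\<close>, the level \<open>min (v t1) d\<close> is a lower barrier for
    \<open>v\<close>.\<close>
  define d where "d = \<alpha> * w t1 powr p / \<beta>"
  define m where "m = min (v t1) d"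
  have d: "d > 0" using \<alpha> \<beta> w_pos[of t1] t1 by (simp add: d_def)
  then have m: "m > 0" using t1 by (simp add: m_def)
  have vm: "m \<le> v t" if "t1 \<le> t" for t
  proof -
    have "(v t1 - m) * exp (\<beta> * t1) \<le> (v t - m) * exp (\<beta> * t)"
    proof (rule DERIV_nonneg_imp_nondecreasing[OF that])
      fix s assume s: "t1 \<le> s" "s \<le> t"
      have "((\<lambda>t. (v t - m) * exp (\<beta> * t)) has_real_derivative
          (\<alpha> * w s powr p - \<beta> * m) * exp (\<beta> * s)) (at s)"
        by (rule derivative_eq_intros v_deriv refl | (use t1 s in \<open>simp add: algebra_simps\<close>))+
      moreover have "\<beta> * m \<le> \<alpha> * w s powr p"
      proof -
        have "\<beta> * m \<le> \<alpha> * w t1 powr p"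
          using \<beta> by (simp add: m_def d_def min_def field_simps)
        also have "\<dots> \<le> \<alpha> * w s powr p"
          using w_mono[of t1 s t1] s t1 p \<alpha> w_pos[of t1] by (intro mult_left_mono powr_mono2) auto
        finally show ?thesis .
      qed
      ultimately show "\<exists>y. ((\<lambda>t. (v t - m) * exp (\<beta> * t)) has_real_derivative y) (at s) \<and> 0 \<le> y"
        by (intro exI conjI) auto
    qed
    moreover have "(v t1 - m) * exp (\<beta> * t1) \<ge> 0" by (simp add: m_def)
    ultimately have "0 \<le> (v t - m) * exp (\<beta> * t)" by linarith
    then show ?thesis by (simp add: zero_le_mult_iff)
  qed
  have "filterlim (\<lambda>t. w t1 + m * (t - t1)) at_top at_top"
    using m by real_asymp
  moreover have "eventually (\<lambda>t. w t1 + m * (t - t1) \<le> w t) at_top"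
    using eventually_ge_at_top[of t1]
  proof eventually_elim
    case (elim t)
    then show ?case using t1 vm by (intro linear_growth[OF _ w_deriv']) auto
  qed
  ultimately have lim: "filterlim w at_top at_top" by (rule filterlim_at_top_mono)
  define k where "k = sqrt (2 * \<alpha> / (p + 1))"
  have k: "k > 0" using \<alpha> p by (simp add: k_def)
  have "((\<lambda>t. v t / w t powr ((p + 1) / 2)) \<longlongrightarrow> k) at_top"
    unfolding k_def
    by (rule ratio_limit[OF _ _ t1(2) _ lim])
      (use t1 eventually_mono[OF eventually_ge_at_top[of t1], of "\<lambda>t. t \<in> {0<..} \<and> t1 \<le> t"] in auto)
  then have "eventually (\<lambda>t. v t / w t powr ((p + 1) / 2) > k / 2) at_top"
    using k by (intro order_tendstoD) auto
  then obtain t2 where t2: "\<And>t. t \<ge> t2 \<Longrightarrow> v t / w t powr ((p + 1) / 2) > k / 2"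
    by (auto simp: eventually_at_top_linorder)
  define t3 where "t3 = max t1 t2"
  \<comment> \<open>The derivative of \<open>w powr (- ((p - 1) / 2))\<close> is
    \<open>- (p - 1) / 2 * v / w powr ((p + 1) / 2)\<close>, which is at most
    \<open>- \<delta>\<close> from \<open>t3\<close> on.\<close>
  define \<delta> where "\<delta> = (p - 1) / 2 * (k / 2)"
  have \<delta>: "\<delta> > 0" using k p by (simp add: \<delta>_def)
  \<comment> \<open>At this time the linear upper bound for \<open>w powr (- ((p - 1) / 2))\<close>
    reaches 0.\<close>
  define t where "t = t3 + w t3 powr (- ((p - 1) / 2)) / \<delta>"
  have t: "t3 \<le> t" "t3 > 0" using \<delta> t1 by (auto simp: t_def t3_def)
  have "- (w t3 powr (- ((p - 1) / 2))) + \<delta> * (t - t3) \<le> - (w t powr (- ((p - 1) / 2)))"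
  proof (rule linear_growth[OF t(1) DERIV_minus[OF w_powr_deriv]])
    fix s assume s: "t3 \<le> s"
    then have "v s / w s powr ((p + 1) / 2) \<ge> k / 2" using t2[of s] by (simp add: t3_def)
    then have "\<delta> \<le> (p - 1) / 2 * (v s / w s powr ((p + 1) / 2))"
      unfolding \<delta>_def using p by (intro mult_left_mono) auto
    moreover have "w s powr (- ((p - 1) / 2) - 1) = inverse (w s powr ((p + 1) / 2))"
    proof -
      have "- ((p - 1) / 2) - 1 = - ((p + 1) / 2)" by (simp add: field_simps)
      then show ?thesis by (simp only: powr_minus)
    qed
    ultimately show "\<delta> \<le> - (- ((p - 1) / 2) * w s powr (- ((p - 1) / 2) - 1) * v s)"
      by (simp add: field_simps)
  qed (use t in auto)
  then have "w t powr (- ((p - 1) / 2)) \<le> 0" using \<delta> by (simp add: t_def)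
  then show False using w_pos[of t] t by simp
qed

text \<open>The power \<open>z = w powr (- ((p - 1) / 2))\<close> vanishes at \<open>T\<close> with
  slope tending to \<open>- \<kappa>\<close>, so \<open>z\<close> is asymptotic to
  \<open>\<kappa> * (T - t)\<close>. The other rates are read off from powers of
  \<open>z\<close>.\<close>

lemma planar_flow_blowup_rate:
  assumes "planar_flow p \<alpha> \<beta> u w {0<..<T}" and T: "T > 0" and u_top: "filterlim u at_top (at_left T)"
  shows "\<exists>A1 A2. A1 > 0 \<and> A2 > 0 \<and>
           u \<sim>[at_left T] (\<lambda>t. A1 * (T - t) powr (- ((p + 1) / (p - 1)))) \<and>
           (\<lambda>t. w t powr p) \<sim>[at_left T] (\<lambda>t. A2 * (T - t) powr (- (2 * p / (p - 1))))"
proof -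
  interpret planar_flow p \<alpha> \<beta> u w "{0<..<T}" by fact
  have ev_gt: "eventually (\<lambda>t. t \<in> {s<..<T}) (at_left T)" if "s < T" for s
    using that by (rule eventually_at_left_real)
  have "\<exists>t\<in>{0<..<T}. T / 2 \<le> t \<and> M < u t" for M
  proof -
    have "eventually (\<lambda>t. M < u t \<and> t \<in> {T/2<..<T}) (at_left T)"
      using T u_top ev_gt[of "T/2"] by (auto simp: filterlim_at_top_dense intro: eventually_conj)
    then obtain t where "M < u t" "t \<in> {T/2<..<T}"
      using eventually_happens'[OF trivial_limit_at_left_real] by blast
    then show ?thesis using T by (intro bexI[of _ t]) auto
  qed
  from ex_v_pos[OF _ this] T obtain t1 where t1: "t1 \<in> {0<..<T}" "v t1 > 0" by auto
  have ev: "eventually (\<lambda>t. t \<in> {0<..<T} \<and> t1 \<le> t) (at_left T)"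
    using ev_gt[of t1] t1 by (auto elim!: eventually_mono)
  \<comment> \<open>\<open>w\<close> is nondecreasing after \<open>t1\<close>, so it suffices that
    it reaches every level \<open>Z\<close>. Otherwise \<open>u' = w powr p\<close> would be at most
    \<open>Z powr p\<close>, and \<open>u\<close> would stay bounded on the bounded
    interval.\<close>
  have lim: "filterlim w at_top (at_left T)"
    unfolding filterlim_at_top
  proof
    fix Z
    show "eventually (\<lambda>t. Z \<le> w t) (at_left T)"
    proof (cases "\<exists>s\<in>{t1..<T}. Z \<le> w s")
      case True
      then obtain s where s: "s \<in> {t1..<T}" "Z \<le> w s" by blast
      have "eventually (\<lambda>t. t \<in> {s<..<T}) (at_left T)" using ev_gt[of s] s by simp
      then show ?thesis
      proof eventually_elim
        case (elim t)
        then show ?case using w_mono[OF t1, of t s] s t1 by auto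
      qed
    next
      case False
      have "eventually (\<lambda>t. u t1 + Z powr p * (T - t1) < u t) (at_left T)"
        using u_top by (auto simp: filterlim_at_top_dense)
      then have "eventually (\<lambda>t. u t1 + Z powr p * (T - t1) < u t \<and> (t \<in> {0<..<T} \<and> t1 \<le> t)) (at_left T)"
        using ev by (rule eventually_conj)
      then obtain t where t: "u t1 + Z powr p * (T - t1) < u t" "t \<in> {0<..<T}" "t1 \<le> t"
        using eventually_happens'[OF trivial_limit_at_left_real] by blast
      have "- u t1 + (- (Z powr p)) * (t - t1) \<le> - u t"
      proof (rule linear_growth[OF t(3) DERIV_minus[OF u_deriv]])
        fix s assume s: "t1 \<le> s" "s \<le> t"
        then have "w s < Z" using False t by force
        then show "- (Z powr p) \<le> - (w s powr p)"
          using w_pos[of s] s t1 t p by (auto intro!: powr_mono2)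
      qed (use t1 t in auto)
      moreover have "Z powr p * (t - t1) \<le> Z powr p * (T - t1)"
        using t by (intro mult_left_mono) auto
      ultimately show ?thesis using t(1) by simp
    qed
  qed
  define k where "k = sqrt (2 * \<alpha> / (p + 1))"
  have k: "k > 0" using \<alpha> p by (simp add: k_def)
  have ratio: "((\<lambda>t. v t / w t powr ((p + 1) / 2)) \<longlongrightarrow> k) (at_left T)"
    unfolding k_def by (rule ratio_limit[OF _ t1 ev lim]) auto
  define z where "z t = w t powr (- ((p - 1) / 2))" for t
  define \<kappa> where "\<kappa> = (p - 1) / 2 * k"
  have \<kappa>: "\<kappa> > 0" using k p by (simp add: \<kappa>_def)
  have z0: "(z \<longlongrightarrow> 0) (at_left T)"
    unfolding z_def using p by (intro tendsto_neg_powr lim) auto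
  have zlim: "((\<lambda>t. z t / (T - t)) \<longlongrightarrow> \<kappa>) (at_left T)"
  proof (rule lhopital_left[OF z0])
    have "((\<lambda>t. T - t) \<longlongrightarrow> T - T) (at_left T)" by (intro tendsto_intros)
    then show "((\<lambda>t. T - t) \<longlongrightarrow> 0) (at_left T)" by simp
    show "eventually (\<lambda>t. T - t \<noteq> 0) (at_left T)" using ev by eventually_elim auto
    show "eventually (\<lambda>t. (-1::real) \<noteq> 0) (at_left T)" by simp
    show "eventually (\<lambda>t. ((\<lambda>t. T - t) has_real_derivative -1) (at t)) (at_left T)"
      by (auto intro!: derivative_eq_intros always_eventually)
    show "eventually (\<lambda>t. (z has_real_derivative
        - ((p - 1) / 2) * w t powr (- ((p - 1) / 2) - 1) * v t) (at t)) (at_left T)"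
      unfolding z_def using ev by eventually_elim (intro w_powr_deriv, simp)
    have "((\<lambda>t. (p - 1) / 2 * (v t / w t powr ((p + 1) / 2))) \<longlongrightarrow> \<kappa>) (at_left T)"
      unfolding \<kappa>_def by (intro tendsto_intros ratio)
    moreover have "w t powr (- ((p - 1) / 2) - 1) = inverse (w t powr ((p + 1) / 2))" for t
    proof -
      have "- ((p - 1) / 2) - 1 = - ((p + 1) / 2)" by (simp add: field_simps)
      then show ?thesis by (simp only: powr_minus)
    qed
    ultimately show "((\<lambda>t. - ((p - 1) / 2) * w t powr (- ((p - 1) / 2) - 1) * v t / -1) \<longlongrightarrow> \<kappa>) (at_left T)"
      by (simp add: field_simps)
  qed
  \<comment> \<open>Used twice: \<open>r = 2 * p / (p - 1)\<close> gives the power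
    \<open>w powr p\<close>, and \<open>r = (p + 1) / (p - 1)\<close> gives
    \<open>w powr ((p + 1) / 2)\<close>.\<close>
  have zpow: "((\<lambda>t. w t powr (r * (p - 1) / 2) / (T - t) powr (- r)) \<longlongrightarrow> \<kappa> powr (- r)) (at_left T)" for r
  proof -
    have "((\<lambda>t. (z t / (T - t)) powr (- r)) \<longlongrightarrow> \<kappa> powr (- r)) (at_left T)"
      using \<kappa> by (intro tendsto_intros zlim) auto
    moreover have "eventually (\<lambda>t. (z t / (T - t)) powr (- r) = 
        w t powr (r * (p - 1) / 2) / (T - t) powr (- r)) (at_left T)"
      using ev
    proof eventually_elim
      case (elim t)
      have "(z t / (T - t)) powr (- r) = z t powr (- r) / (T - t) powr (- r)"
        by (rule powr_divide)
      moreover have "- ((p - 1) / 2) * - r = r * (p - 1) / 2" by simp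
      ultimately show ?case by (simp only: z_def powr_powr)
    qed
    ultimately show ?thesis by (simp cong: tendsto_cong)
  qed
  have "((\<lambda>t. w t powr p / (T - t) powr (- (2 * p / (p - 1)))) \<longlongrightarrow> \<kappa> powr (- (2 * p / (p - 1)))) (at_left T)"
    using zpow[of "2 * p / (p - 1)"] p by simp
  then have 1: "(\<lambda>t. w t powr p) \<sim>[at_left T]
      (\<lambda>t. \<kappa> powr (- (2 * p / (p - 1))) * (T - t) powr (- (2 * p / (p - 1))))"
    using \<kappa> by (intro asymp_equivI'_const) auto
  let ?r = "(p + 1) / (p - 1)" and ?q = "(p + 1) / 2"
  have "((\<lambda>t. w t powr ?q / (T - t) powr (- ?r)) \<longlongrightarrow> \<kappa> powr (- ?r)) (at_left T)"
    using zpow[of ?r] p by simp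
  \<comment> \<open>\<open>u = (v + \<beta> * w) / \<alpha>\<close> is factored by
    \<open>w powr ?q\<close>. Since \<open>w / w powr ?q = z\<close> tends to 0, only
    \<open>v\<close> contributes to the limit.\<close>
  then have "((\<lambda>t. (v t / w t powr ?q + \<beta> * z t) / \<alpha> * (w t powr ?q / (T - t) powr (- ?r))) \<longlongrightarrow>
      (k + \<beta> * 0) / \<alpha> * \<kappa> powr (- ?r)) (at_left T)"
    using \<alpha> by (intro tendsto_intros ratio z0) auto
  moreover have "eventually (\<lambda>t. (v t / w t powr ?q + \<beta> * z t) / \<alpha> * (w t powr ?q / (T - t) powr (- ?r))
      = u t / (T - t) powr (- ?r)) (at_left T)"
    using ev
  proof eventually_elim
    case (elim t)
    then have w: "w t > 0" using w_pos by simp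
    have "z t * w t powr ?q = w t powr (- ((p - 1) / 2) + ?q)"
      unfolding z_def by (rule powr_add[symmetric])
    also have "- ((p - 1) / 2) + ?q = 1" by (simp add: field_simps)
    finally have "z t * w t powr ?q = w t" using w by simp
    then have "(v t / w t powr ?q + \<beta> * z t) / \<alpha> * w t powr ?q = (v t + \<beta> * w t) / \<alpha>"
      using w \<alpha> by (simp add: field_simps)
    also have "\<dots> = u t" using \<alpha> by (simp add: v_def)
    finally show ?case by (metis times_divide_eq_right)
  qed
  ultimately have "((\<lambda>t. u t / (T - t) powr (- ?r)) \<longlongrightarrow> (k + \<beta> * 0) / \<alpha> * \<kappa> powr (- ?r)) (at_left T)"
    by (rule Lim_transform_eventually)
  then have "((\<lambda>t. u t / (T - t) powr (- ?r)) \<longlongrightarrow> k / \<alpha> * \<kappa> powr (- ?r)) (at_left T)"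
    by simp
  then have 2: "u \<sim>[at_left T] (\<lambda>t. (k / \<alpha> * \<kappa> powr (- ?r)) * (T - t) powr (- ?r))"
    using \<kappa> k \<alpha> by (intro asymp_equivI'_const) auto
  show ?thesis
    using 1 2 \<kappa> k \<alpha>
    by (intro exI[of _ "k / \<alpha> * \<kappa> powr (- ?r)"] exI[of _ "\<kappa> powr (- (2 * p / (p - 1)))"]) simp
qed

section \<open>Monotone iteration\<close>

text \<open>The history acts on positive times only through two numbers, the values
  \<open>u0\<close> and \<open>w0\<close> of the solution and of the delay integral at time
  0.\<close>

locale delay_ode =
  fixes p \<alpha> \<beta> u0 w0 :: real
  assumes p: "p > 1" and \<alpha>: "\<alpha> > 0" and \<beta>: "\<beta> > 0" and u0: "u0 > 0" and w0: "w0 > 0"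
begin

text \<open>
  \<open>W x t\<close> is the delay integral of \<open>x\<close> up to \<open>t\<close>; the part over \<open>{..0}\<close> is \<open>exp (- \<beta> * t) * w0\<close>.
  Solutions are the fixed points of \<open>\<Phi>\<close>, with \<open>u0\<close> the value of the history at \<open>0\<close>.
\<close>

definition W :: "(real \<Rightarrow> real) \<Rightarrow> real \<Rightarrow> real" where
  "W x t = exp (- \<beta> * t) * (w0 + \<alpha> * integral {0..t} (\<lambda>s. exp (\<beta> * s) * x s))"

definition \<Phi> :: "(real \<Rightarrow> real) \<Rightarrow> real \<Rightarrow> real" where
  "\<Phi> x t = u0 + integral {0..t} (\<lambda>s. W x s powr p)"

definition iter :: "nat \<Rightarrow> real \<Rightarrow> real" where
  "iter n = (\<Phi> ^^ n) (\<lambda>_. u0)"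

lemma iter_0 [simp]: "iter 0 t = u0" and iter_Suc: "iter (Suc n) = \<Phi> (iter n)"
  by (simp_all add: iter_def)

lemma integrable_weighted:
  assumes "continuous_on {0..b} x" "t \<le> b"
  shows "(\<lambda>s. exp (\<beta> * s) * x s) integrable_on {0..t}"
  by (intro integrable_continuous_interval continuous_intros continuous_on_subset[OF assms(1)])
    (use assms in auto)

lemma W_continuous:
  assumes "(\<lambda>s. exp (\<beta> * s) * x s) integrable_on {0..b}"
  shows "continuous_on {0..b} (W x)"
  unfolding W_def by (intro continuous_intros indefinite_integral_continuous_1 assms)

lemma W_pos:
  assumes "\<And>s. s \<in> {0..t} \<Longrightarrow> x s \<ge> 0"
  shows "W x t > 0"
proof -
  have "integral {0..t} (\<lambda>s. exp (\<beta> * s) * x s) \<ge> 0"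
    \<comment> \<open>In the non-integrable case the integral has the default value 0.\<close>
    by (cases "(\<lambda>s. exp (\<beta> * s) * x s) integrable_on {0..t}")
      (use assms in \<open>auto intro!: integral_nonneg simp: not_integrable_integral\<close>)
  with \<alpha> w0 show ?thesis
    by (auto simp: W_def intro!: mult_pos_pos add_pos_nonneg)
qed

lemma W_mono:
  assumes "(\<lambda>s. exp (\<beta> * s) * x s) integrable_on {0..t}"
    and "(\<lambda>s. exp (\<beta> * s) * y s) integrable_on {0..t}"
    and "\<And>s. s \<in> {0..t} \<Longrightarrow> x s \<le> y s"
  shows "W x t \<le> W y t"
proof -
  have "integral {0..t} (\<lambda>s. exp (\<beta> * s) * x s) \<le> integral {0..t} (\<lambda>s. exp (\<beta> * s) * y s)"
    by (intro integral_le assms) (auto intro!: mult_left_mono assms)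
  with \<alpha> show ?thesis by (auto simp: W_def)
qed

text \<open>The prefactor \<open>exp (- \<beta> * t)\<close> cancels the largest value of the weight
  on \<open>{0..t}\<close>.\<close>

lemma W_le:
  assumes "continuous_on {0..t} x" "t \<ge> 0" "\<And>s. s \<in> {0..t} \<Longrightarrow> x s \<le> N" "N \<ge> 0"
  shows "W x t \<le> w0 + \<alpha> * t * N"
proof -
  have "integral {0..t} (\<lambda>s. exp (\<beta> * s) * x s) \<le> integral {0..t} (\<lambda>s. exp (\<beta> * t) * N)"
  proof (intro integral_le integrable_weighted[of t])
    show "exp (\<beta> * s) * x s \<le> exp (\<beta> * t) * N" if "s \<in> {0..t}" for s
    proof -
      have "exp (\<beta> * s) * x s \<le> exp (\<beta> * s) * N"
        using assms(3)[OF that] by simp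
      also have "\<dots> \<le> exp (\<beta> * t) * N"
        using that \<beta> assms(4) by (intro mult_right_mono) auto
      finally show ?thesis .
    qed
  qed (use assms in auto)
  also have "\<dots> = t * (exp (\<beta> * t) * N)" using assms by simp
  finally have "W x t \<le> exp (- \<beta> * t) * (w0 + \<alpha> * (t * (exp (\<beta> * t) * N)))"
    using \<alpha> by (simp add: W_def)
  also have "\<dots> = exp (- \<beta> * t) * w0 + \<alpha> * t * N"
    by (simp add: algebra_simps exp_minus field_simps)
  also have "\<dots> \<le> w0 + \<alpha> * t * N"
    using w0 \<beta> assms by (simp add: mult_left_le_one_le)
  finally show ?thesis .
qed

lemma W_powr_continuous:
  assumes "continuous_on {0..b} x" "\<And>s. s \<in> {0..b} \<Longrightarrow> x s \<ge> 0"
  shows "continuous_on {0..b} (\<lambda>s. W x s powr p)"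
  using p by (intro continuous_on_powr' W_continuous integrable_weighted[of b] assms)
     (auto intro!: continuous_intros less_imp_le[OF W_pos] assms)

lemma \<Phi>_continuous:
  assumes "continuous_on {0..b} x" "\<And>s. s \<in> {0..b} \<Longrightarrow> x s \<ge> 0"
  shows "continuous_on {0..b} (\<Phi> x)"
  unfolding \<Phi>_def
  by (intro continuous_intros indefinite_integral_continuous_1 integrable_continuous_interval
      W_powr_continuous assms)

lemma \<Phi>_ge: "\<Phi> x t \<ge> u0"
proof -
  have "integral {0..t} (\<lambda>s. W x s powr p) \<ge> 0"
    by (cases "(\<lambda>s. W x s powr p) integrable_on {0..t}")
      (auto intro!: integral_nonneg simp: not_integrable_integral)
  then show ?thesis by (simp add: \<Phi>_def)
qed

lemma \<Phi>_mono:
  assumes "continuous_on {0..t} x" "continuous_on {0..t} y"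
    and "\<And>s. s \<in> {0..t} \<Longrightarrow> 0 \<le> x s" "\<And>s. s \<in> {0..t} \<Longrightarrow> x s \<le> y s"
  shows "\<Phi> x t \<le> \<Phi> y t"
proof -
  have "integral {0..t} (\<lambda>s. W x s powr p) \<le> integral {0..t} (\<lambda>s. W y s powr p)"
  proof (intro integral_le integrable_continuous_interval W_powr_continuous assms)
    show "0 \<le> y s" if "s \<in> {0..t}" for s using assms(3,4)[OF that] by simp
    show "W x s powr p \<le> W y s powr p" if "s \<in> {0..t}" for s
      using p that assms
      by (intro powr_mono2 W_mono integrable_weighted[of t] less_imp_le[OF W_pos]) auto
  qed
  then show ?thesis by (simp add: \<Phi>_def)
qed

lemma \<Phi>_split:
  assumes "continuous_on {0..t} x" "\<And>s. s \<in> {0..t} \<Longrightarrow> x s \<ge> 0" "0 \<le> a" "a \<le> t"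
  shows "\<Phi> x t = \<Phi> x a + integral {a..t} (\<lambda>s. W x s powr p)"
  using Henstock_Kurzweil_Integration.integral_combine[of 0 a t "\<lambda>s. W x s powr p"]
    integrable_continuous_interval[OF W_powr_continuous[OF assms(1,2)]] assms
  by (simp add: \<Phi>_def)

lemma \<Phi>_nondecreasing:
  assumes "continuous_on {0..t} x" "\<And>s. s \<in> {0..t} \<Longrightarrow> x s \<ge> 0" "0 \<le> a" "a \<le> t"
  shows "\<Phi> x a \<le> \<Phi> x t"
proof -
  have "(\<lambda>s. W x s powr p) integrable_on {a..t}"
    by (intro integrable_continuous_interval continuous_on_subset[OF W_powr_continuous[OF assms(1,2)]])
      (use assms in auto)
  then have "0 \<le> integral {a..t} (\<lambda>s. W x s powr p)" by (intro integral_nonneg) auto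
  then show ?thesis using \<Phi>_split[OF assms] by simp
qed

lemma iter_ge: "iter n t \<ge> u0"
  by (cases n) (simp_all add: iter_Suc \<Phi>_ge)

lemma iter_nonneg: "iter n t \<ge> 0"
  using iter_ge[of n t] u0 by simp

lemma iter_continuous: "continuous_on {0..b} (iter n)"
proof (induction n)
  case 0
  then show ?case by (simp add: iter_def)
next
  case (Suc n)
  then show ?case by (simp add: iter_Suc \<Phi>_continuous iter_nonneg)
qed

lemma iter_incr: "iter n t \<le> iter (Suc n) t"
proof (induction n arbitrary: t)
  case 0
  then show ?case by (simp add: iter_Suc \<Phi>_ge)
next
  case (Suc n)
  show ?case
    unfolding iter_Suc[of "Suc n"] unfolding iter_Suc[of n]
    by (rule \<Phi>_mono) (use Suc iter_continuous iter_nonneg in \<open>auto simp: iter_Suc[symmetric]\<close>)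
qed

lemma iter_incseq: "incseq (\<lambda>n. iter n t)"
  using iter_incr by (intro incseq_SucI)

lemma iter_nondecreasing:
  assumes "0 \<le> a" "a \<le> t"
  shows "iter n a \<le> iter n t"
  by (cases n) (auto simp: iter_Suc iter_continuous iter_nonneg assms intro!: \<Phi>_nondecreasing)

text \<open>A local existence time common to all iterates. While an iterate is at most
  \<open>M + 1\<close>, the integrand that produces the next one is at most \<open>B\<close>, so
  over a length of at most \<open>1 / B\<close> the next iterate gains at most 1.\<close>

lemma iter_bound_step:
  assumes "t0 \<ge> 0" "\<And>n. iter n t0 \<le> M"
  obtains e where "e > 0" "\<And>n. iter n (t0 + e) \<le> M + 1"
proof -
  have M: "M > 0" using assms(2)[of 0] u0 by simp
  define B where "B = (w0 + \<alpha> * (t0 + 1) * (M + 1)) powr p"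
  define e where "e = min 1 (1 / B)"
  have "w0 + \<alpha> * (t0 + 1) * (M + 1) > 0"
    using w0 \<alpha> M assms by (intro add_pos_nonneg mult_nonneg_nonneg) auto
  then have B: "B > 0" by (simp add: B_def)
  then have e: "e > 0" "e \<le> 1" "e * B \<le> 1" 
    by (auto simp: e_def min_def field_simps)
  \<comment> \<open>The induction covers all times from 0 on, because \<open>W\<close> sees the
    whole past of the iterate.\<close>
  have "iter n t \<le> M + 1" if "0 \<le> t" "t \<le> t0 + e" for n t
    using that
  proof (induction n arbitrary: t)
    case 0
    then show ?case using assms(2)[of 0] by simp
  next
    case (Suc n)
    show ?case
    proof (cases "t \<le> t0")
      case True
      then show ?thesis using iter_nondecreasing[of t t0 "Suc n"] assms(2)[of "Suc n"] Suc by simp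
    next
      case False
      have WB: "W (iter n) s powr p \<le> B" if "s \<in> {t0..t}" for s
        unfolding B_def
      proof (intro powr_mono2 less_imp_le[OF W_pos] iter_nonneg)
        have "W (iter n) s \<le> w0 + \<alpha> * s * (M + 1)"
          using that assms Suc M by (intro W_le iter_continuous) auto
        also have "\<dots> \<le> w0 + \<alpha> * (t0 + 1) * (M + 1)"
          using that \<alpha> M Suc.prems e by (auto intro!: mult_right_mono mult_left_mono)
        finally show "W (iter n) s \<le> w0 + \<alpha> * (t0 + 1) * (M + 1)" .
      qed (use p in auto)
      have "integral {t0..t} (\<lambda>s. W (iter n) s powr p) \<le> integral {t0..t} (\<lambda>s. B)"
        by (intro integral_le WB integrable_continuous_interval
              continuous_on_subset[OF W_powr_continuous[OF iter_continuous[of t n]]])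
           (use assms in \<open>auto simp: iter_nonneg\<close>)
      also have "\<dots> = (t - t0) * B" using False by simp
      also have "\<dots> \<le> e * B" using Suc.prems B by (intro mult_right_mono) auto
      also have "\<dots> \<le> 1" by (rule e)
      finally have "integral {t0..t} (\<lambda>s. W (iter n) s powr p) \<le> 1" .
      moreover have "iter (Suc n) t = iter (Suc n) t0 + integral {t0..t} (\<lambda>s. W (iter n) s powr p)"
        unfolding iter_Suc using False assms
        by (intro \<Phi>_split iter_continuous iter_nonneg) auto
      ultimately show ?thesis using assms(2)[of "Suc n"] by simp
    qed
  qed
  then show ?thesis using e assms(1) by (intro that[of e]) auto
qed

section \<open>The minimal solution as the limit of the iterates\<close>

definition bounded_times :: "real set" where
  "bounded_times = {t. t \<ge> 0 \<and> bdd_above (range (\<lambda>n. iter n t))}"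

text \<open>The supremum is meaningful on \<open>bounded_times\<close>, where it is the limit of the
  increasing iterates.\<close>

definition minsol :: "real \<Rightarrow> real" where
  "minsol t = (SUP n. iter n t)"

lemma bounded_times_downward:
  assumes "t \<in> bounded_times" "0 \<le> s" "s \<le> t"
  shows "s \<in> bounded_times"
proof -
  obtain M where "\<And>n. iter n t \<le> M"
    using assms(1) by (auto simp: bounded_times_def bdd_above_def)
  with iter_nondecreasing[OF assms(2,3)] show ?thesis
    using assms(2) unfolding bounded_times_def by (auto intro!: bdd_aboveI[of _ M] intro: order_trans)
qed

lemma iter_tendsto_minsol: "t \<in> bounded_times \<Longrightarrow> (\<lambda>n. iter n t) \<longlonglongrightarrow> minsol t"
  unfolding minsol_def bounded_times_def by (intro LIMSEQ_incseq_SUP iter_incseq) auto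

lemma iter_le_minsol: "t \<in> bounded_times \<Longrightarrow> iter n t \<le> minsol t"
  unfolding minsol_def bounded_times_def by (intro cSUP_upper) auto

lemma minsol_ge: "t \<in> bounded_times \<Longrightarrow> minsol t \<ge> u0"
  using iter_le_minsol[of t 0] by simp

lemma minsol_nondecreasing:
  assumes "t \<in> bounded_times" "0 \<le> s" "s \<le> t"
  shows "minsol s \<le> minsol t"
  using LIMSEQ_le[OF iter_tendsto_minsol[OF bounded_times_downward[OF assms]]
      iter_tendsto_minsol[OF assms(1)]] iter_nondecreasing[OF assms(2,3)] by blast

text \<open>Monotone convergence passes to the limit twice, inside \<open>W\<close> and then inside
  \<open>\<Phi>\<close>. Continuity comes last: the right-hand side of the fixed point equation is
  an indefinite integral.\<close>

lemma minsol_fixpoint: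
  assumes t: "t \<in> bounded_times"
  shows "minsol t = \<Phi> minsol t" "continuous_on {0..t} minsol"
proof -
  have bt: "s \<in> bounded_times" if "s \<in> {0..t}" for s
    using bounded_times_downward[OF t] that by auto
  have le: "iter n s \<le> minsol t" if "s \<in> {0..t}" for n s
    using iter_le_minsol[OF bt[OF that], of n] minsol_nondecreasing[OF t, of s] that by auto
  \<comment> \<open>Integrability of the limit is part of the conclusion, as continuity of
    \<open>minsol\<close> is still open at this point.\<close>
  have *: "(\<lambda>r. exp (\<beta> * r) * minsol r) integrable_on {0..s} \<and>
      (\<lambda>n. integral {0..s} (\<lambda>r. exp (\<beta> * r) * iter n r)) \<longlonglongrightarrow> 
        integral {0..s} (\<lambda>r. exp (\<beta> * r) * minsol r)" if s: "s \<in> {0..t}" for s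
  proof (rule monotone_convergence_increasing)
    show "(\<lambda>r. exp (\<beta> * r) * iter n r) integrable_on {0..s}" for n
      by (rule integrable_weighted[OF iter_continuous[of s]]) auto
    show "(\<lambda>n. exp (\<beta> * r) * iter n r) \<longlonglongrightarrow> exp (\<beta> * r) * minsol r" if "r \<in> {0..s}" for r
      using that s by (intro tendsto_intros iter_tendsto_minsol bt) auto
    have "integral {0..s} (\<lambda>r. exp (\<beta> * r) * iter n r) \<in> {0..s * (exp (\<beta> * t) * minsol t)}" for n
    proof -
      have "integral {0..s} (\<lambda>r. exp (\<beta> * r) * iter n r) \<le> integral {0..s} (\<lambda>r. exp (\<beta> * t) * minsol t)"
        by (intro integral_le integrable_weighted[OF iter_continuous[of s]] mult_mono le iter_nonneg)
          (use s \<beta> in auto)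
      moreover have "integral {0..s} (\<lambda>r. exp (\<beta> * r) * iter n r) \<ge> 0"
        by (intro integral_nonneg integrable_weighted[OF iter_continuous[of s]]) (auto simp: iter_nonneg)
      ultimately show ?thesis using s by (simp add: mult_ac)
    qed
    then show "bounded (range (\<lambda>n. integral {0..s} (\<lambda>r. exp (\<beta> * r) * iter n r)))"
      by (intro bounded_subset[OF bounded_closed_interval[of 0 "s * (exp (\<beta> * t) * minsol t)"]]) blast
  qed (auto simp: iter_incr)
  have Wlim: "(\<lambda>n. W (iter n) s) \<longlonglongrightarrow> W minsol s" if "s \<in> {0..t}" for s
    unfolding W_def using *[OF that] by (intro tendsto_intros) auto
  have Wpos: "W minsol s > 0" if "s \<in> {0..t}" for s
    using that minsol_ge u0 by (intro W_pos) (force intro: order_trans[OF less_imp_le[OF u0] minsol_ge[OF bt]])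
  have Wle: "W (iter n) s \<le> W minsol s" if "s \<in> {0..t}" for n s
    using that * bt
    by (intro W_mono integrable_weighted[OF iter_continuous[of s]] iter_le_minsol) auto
  have contW: "continuous_on {0..t} (W minsol)"
    using * t by (intro W_continuous) (auto simp: bounded_times_def)
  have cP: "continuous_on {0..t} (\<lambda>r. W minsol r powr p)"
    using Wpos by (intro continuous_intros contW) force
  have **: "minsol s = \<Phi> minsol s" if s: "s \<in> {0..t}" for s
  proof -
    have "(\<lambda>n. integral {0..s} (\<lambda>r. W (iter n) r powr p)) \<longlonglongrightarrow> integral {0..s} (\<lambda>r. W minsol r powr p)"
    proof (rule monotone_convergence_increasing[THEN conjunct2])
      show I: "(\<lambda>r. W (iter n) r powr p) integrable_on {0..s}" for n
        by (intro integrable_continuous_interval W_powr_continuous iter_continuous iter_nonneg)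
      show "W (iter n) r powr p \<le> W (iter (Suc n)) r powr p" for n r
        using p by (intro powr_mono2 W_mono integrable_weighted[OF iter_continuous[of r]] iter_incr 
            less_imp_le[OF W_pos] iter_nonneg) auto
      show "(\<lambda>n. W (iter n) r powr p) \<longlonglongrightarrow> W minsol r powr p" if "r \<in> {0..s}" for r
        using Wpos[of r] that s by (intro tendsto_intros Wlim) auto
      have "integral {0..s} (\<lambda>r. W (iter n) r powr p) \<in> {0..integral {0..s} (\<lambda>r. W minsol r powr p)}" for n
      proof -
        have "integral {0..s} (\<lambda>r. W (iter n) r powr p) \<le> integral {0..s} (\<lambda>r. W minsol r powr p)"
          by (intro integral_le I integrable_continuous_interval continuous_on_subset[OF cP] powr_mono2
             Wle less_imp_le[OF W_pos] iter_nonneg) (use s p in auto)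
        moreover have "integral {0..s} (\<lambda>r. W (iter n) r powr p) \<ge> 0"
          by (intro integral_nonneg I) auto
        ultimately show ?thesis by simp
      qed
      then show "bounded (range (\<lambda>n. integral {0..s} (\<lambda>r. W (iter n) r powr p)))"
        by (intro bounded_subset[OF bounded_closed_interval[of 0 "integral {0..s} (\<lambda>r. W minsol r powr p)"]]) blast
    qed
    then have "(\<lambda>n. iter (Suc n) s) \<longlonglongrightarrow> \<Phi> minsol s"
      unfolding iter_Suc \<Phi>_def by (intro tendsto_intros)
    moreover have "(\<lambda>n. iter (Suc n) s) \<longlonglongrightarrow> minsol s"
      using iter_tendsto_minsol[OF bt[OF s]] by (rule LIMSEQ_Suc)
    ultimately show ?thesis using LIMSEQ_unique by blast
  qed
  show "minsol t = \<Phi> minsol t" using ** t by (auto simp: bounded_times_def)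
  have "continuous_on {0..t} (\<Phi> minsol)"
    unfolding \<Phi>_def
    by (intro continuous_intros indefinite_integral_continuous_1 integrable_continuous_interval cP)
  then show "continuous_on {0..t} minsol"
    using continuous_on_cong[OF refl **, of "{0..t}"] by simp
qed

section \<open>Derivatives, comparison and uniqueness of fixed points\<close>

lemma \<Phi>_0 [simp]: "\<Phi> x 0 = u0"
  by (simp add: \<Phi>_def)

lemma W_0 [simp]: "W x 0 = w0"
  by (simp add: W_def)

lemma W_deriv:
  assumes "continuous_on {0..b} x" "0 < t" "t < b"
  shows "(W x has_real_derivative \<alpha> * x t - \<beta> * W x t) (at t)"
proof -
  have at: "at t within {0..b} = at t" using assms by (intro at_within_interior) auto
  have "continuous_on {0..b} (\<lambda>s. exp (\<beta> * s) * x s)"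
    by (intro continuous_intros assms)
  then have *: "((\<lambda>t. integral {0..t} (\<lambda>s. exp (\<beta> * s) * x s)) has_real_derivative
      exp (\<beta> * t) * x t) (at t)"
    using integral_has_real_derivative[of 0 b _ t] assms by (auto simp: at)
  have "(W x has_real_derivative exp (- \<beta> * t) * (\<alpha> * (exp (\<beta> * t) * x t)) - \<beta> * W x t) (at t)"
    unfolding W_def[abs_def]
    by (rule derivative_eq_intros * refl | simp add: algebra_simps)+
  then show ?thesis by (simp add: exp_minus field_simps)
qed

lemma \<Phi>_deriv:
  assumes "continuous_on {0..b} x" "\<And>s. s \<in> {0..b} \<Longrightarrow> x s \<ge> 0" "0 < t" "t < b"
  shows "(\<Phi> x has_real_derivative W x t powr p) (at t)"
proof -
  have at: "at t within {0..b} = at t" using assms by (intro at_within_interior) auto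
  have "((\<lambda>t. integral {0..t} (\<lambda>s. W x s powr p)) has_real_derivative W x t powr p) (at t)"
    using integral_has_real_derivative[OF W_powr_continuous[OF assms(1,2)], of t] assms by (auto simp: at)
  then show ?thesis
    unfolding \<Phi>_def[abs_def] by (auto intro!: derivative_eq_intros)
qed

lemma fixpoint_deriv:
  assumes "continuous_on {0..b} x" "\<And>s. s \<in> {0..b} \<Longrightarrow> x s = \<Phi> x s" "0 < t" "t < b"
  shows "(x has_real_derivative W x t powr p) (at t)"
proof (rule has_field_derivative_transform_within_open)
  have "x s \<ge> 0" if "s \<in> {0..b}" for s
    using \<Phi>_ge[of x s] assms(2)[OF that] u0 by simp
  then show "(\<Phi> x has_real_derivative W x t powr p) (at t)"
    using assms by (intro \<Phi>_deriv[of b]) auto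
qed (use assms in \<open>auto intro!: assms(2)[symmetric] open_greaterThanLessThan[of 0 b]\<close>)

text \<open>Induction with the monotonicity of \<open>\<Phi>\<close>. This serves two ends: a
  solution bounds the iterates, so its interval lies in \<open>bounded_times\<close>, and it
  dominates \<open>minsol\<close>.\<close>

lemma iter_le_fixpoint:
  assumes "continuous_on {0..b} x" "\<And>s. s \<in> {0..b} \<Longrightarrow> x s = \<Phi> x s" "t \<in> {0..b}"
  shows "iter n t \<le> x t"
  using assms(3)
proof (induction n arbitrary: t)
  case 0
  then show ?case using \<Phi>_ge[of x t] assms(2)[of t] by simp
next
  case (Suc n)
  have "\<Phi> (iter n) t \<le> \<Phi> x t"
    by (intro \<Phi>_mono iter_continuous iter_nonneg continuous_on_subset[OF assms(1)])
      (use Suc in auto)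
  then show ?case using assms(2)[OF Suc.prems] by (simp add: iter_Suc)
qed

text \<open>
  For ordered solutions \<open>x \<le> y\<close> both differences \<open>y - x\<close> and \<open>W y - W x\<close> are nonnegative, so a
  Gronwall estimate applies to their sum without absolute values.
\<close>

lemma ordered_fixpoints_eq:
  assumes x: "continuous_on {0..b} x" "\<And>s. s \<in> {0..b} \<Longrightarrow> x s = \<Phi> x s"
    and y: "continuous_on {0..b} y" "\<And>s. s \<in> {0..b} \<Longrightarrow> y s = \<Phi> y s"
    and le: "\<And>s. s \<in> {0..b} \<Longrightarrow> x s \<le> y s" and b: "b \<ge> 0"
  shows "x b = y b"
proof -
  have x0: "x s \<ge> 0" if "s \<in> {0..b}" for s
    using \<Phi>_ge[of x s] x(2)[OF that] u0 by simp
  have Wle: "W x s \<le> W y s" if "s \<in> {0..b}" for s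
    using that by (intro W_mono integrable_weighted[OF x(1)] integrable_weighted[OF y(1)] le) auto
  have Wx: "W x s > 0" if "s \<in> {0..b}" for s
    using that by (intro W_pos x0) auto
  have cW: "continuous_on {0..b} (W x)" "continuous_on {0..b} (W y)"
    using integrable_weighted[OF x(1), of b] integrable_weighted[OF y(1), of b]
    by (auto intro: W_continuous)
  obtain M where M: "\<And>s. s \<in> {0..b} \<Longrightarrow> W y s \<le> M"
    using compact_imp_bounded[OF compact_continuous_image[OF cW(2) compact_Icc]]
    by (auto simp: bounded_iff) (metis abs_le_D1 atLeastAtMost_iff)
  \<comment> \<open>One-sided Lipschitz bound by the mean value theorem, between positive values
    bounded by \<open>M\<close>.\<close>
  have lip: "W y s powr p - W x s powr p \<le> p * M powr (p - 1) * (W y s - W x s)"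
    if s: "s \<in> {0..b}" for s
  proof (cases "W x s = W y s")
    case False
    then have "W x s < W y s" using Wle[OF s] by simp
    then obtain \<xi> where \<xi>: "W x s < \<xi>" "\<xi> < W y s"
      "W y s powr p - W x s powr p = (W y s - W x s) * (p * \<xi> powr (p - 1))"
      using MVT2[of "W x s" "W y s" "\<lambda>z. z powr p" "\<lambda>z. p * z powr (p - 1)"]
        Wx[OF s] has_real_derivative_powr by force
    have "\<xi> powr (p - 1) \<le> M powr (p - 1)"
      using \<xi> Wx[OF s] M[OF s] p by (intro powr_mono2) auto
    then have "(W y s - W x s) * (p * \<xi> powr (p - 1)) \<le> (W y s - W x s) * (p * M powr (p - 1))"
      using p Wle[OF s] by (intro mult_left_mono) auto
    with \<xi> show ?thesis by (simp add: mult_ac)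
  qed simp
  \<comment> \<open>\<open>K\<close> dominates both coefficients in the estimate of
    \<open>d'\<close>: \<open>\<alpha>\<close> on \<open>y - x\<close> and the Lipschitz constant on
    \<open>W y - W x\<close>. The damping contributes a nonpositive term.\<close>
  define K where "K = \<alpha> + p * M powr (p - 1)"
  define d where "d s = (y s - x s) + (W y s - W x s)" for s
  have "d b * exp (- K * b) \<le> d 0 * exp (- K * 0)"
  proof (rule DERIV_nonpos_imp_decreasing_open[OF b])
    show "continuous_on {0..b} (\<lambda>s. d s * exp (- K * s))"
      unfolding d_def by (intro continuous_intros cW x y)
    fix s assume s: "0 < s" "s < b"
    let ?d' = "(W y s powr p - W x s powr p) + (\<alpha> * (y s - x s) - \<beta> * (W y s - W x s))"
    have "(d has_real_derivative ?d') (at s)"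
      unfolding d_def[abs_def]
      using fixpoint_deriv[OF x s] fixpoint_deriv[OF y s] W_deriv[OF x(1) s] W_deriv[OF y(1) s]
      by (auto intro!: derivative_eq_intros simp: algebra_simps)
    then have "((\<lambda>s. d s * exp (- K * s)) has_real_derivative (?d' - K * d s) * exp (- K * s)) (at s)"
      by (auto intro!: derivative_eq_intros simp: algebra_simps)
    moreover have "?d' \<le> K * d s"
    proof -
      have s': "s \<in> {0..b}" using s by simp
      have "?d' \<le> p * M powr (p - 1) * (W y s - W x s) + \<alpha> * (y s - x s)"
        using lip[OF s'] Wle[OF s'] \<beta> by (smt (verit) mult_nonneg_nonneg)
      also have "\<dots> \<le> K * (W y s - W x s) + K * (y s - x s)"
        using \<alpha> p Wle[OF s'] le[OF s'] unfolding K_def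
        by (intro add_mono mult_right_mono) auto
      finally show ?thesis by (simp add: d_def algebra_simps)
    qed
    ultimately show "\<exists>z. ((\<lambda>s. d s * exp (- K * s)) has_real_derivative z) (at s) \<and> z \<le> 0"
      by (intro exI conjI) (auto intro: mult_nonpos_nonneg)
  qed
  moreover have "d 0 = 0" using x(2)[of 0] y(2)[of 0] b by (simp add: d_def)
  ultimately have "d b \<le> 0" by (simp add: mult_le_0_iff not_le)
  then show ?thesis using Wle[of b] le[of b] b by (simp add: d_def)
qed

section \<open>The maximal interval and blow-up\<close>

lemma bounded_times_0: "0 \<in> bounded_times"
proof -
  have "iter n 0 = u0" for n by (cases n) (simp_all add: iter_Suc)
  then show ?thesis by (simp add: bounded_times_def)
qed

text \<open>A two-sided derivative at \<open>t\<close> requires the fixed point equation slightly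
  beyond \<open>t\<close>, hence the bounded time \<open>b > t\<close>.\<close>

lemma minsol_planar_flow:
  assumes "\<And>t. t \<in> J \<Longrightarrow> 0 < t \<and> (\<exists>b\<in>bounded_times. t < b)"
    and "\<And>a b t. a \<in> J \<Longrightarrow> b \<in> J \<Longrightarrow> a \<le> t \<Longrightarrow> t \<le> b \<Longrightarrow> t \<in> J"
  shows "planar_flow p \<alpha> \<beta> minsol (W minsol) J"
proof
  fix t assume "t \<in> J"
  then obtain b where b: "0 < t" "b \<in> bounded_times" "t < b" using assms(1) by blast
  have eq: "minsol s = \<Phi> minsol s" if "s \<in> {0..b}" for s
    using minsol_fixpoint(1)[OF bounded_times_downward[OF b(2)]] that by simp
  have c: "continuous_on {0..b} minsol" by (rule minsol_fixpoint[OF b(2)])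
  show "(minsol has_real_derivative W minsol t powr p) (at t)"
    by (rule fixpoint_deriv[OF c eq b(1,3)])
  show "(W minsol has_real_derivative \<alpha> * minsol t - \<beta> * W minsol t) (at t)"
    by (rule W_deriv[OF c b(1,3)])
  show "W minsol t > 0"
  proof (rule W_pos)
    fix s assume "s \<in> {0..t}"
    then have "minsol s \<ge> u0"
      using b by (intro minsol_ge bounded_times_downward[OF b(2)]) auto
    then show "minsol s \<ge> 0" using u0 by simp
  qed
next
  show "t \<in> J" if "a \<in> J" "b \<in> J" "a \<le> t" "t \<le> b" for a b t
    by (rule assms(2)[OF that])
qed (rule p \<alpha> \<beta>)+

text \<open>The set is closed downwards. By \<open>iter_bound_step\<close> it has no greatest
  element, and if it were unbounded, \<open>minsol\<close> would be a global trajectory, against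
  \<open>planar_flow_no_global\<close>.\<close>

lemma bounded_times_eq: "\<exists>T>0. bounded_times = {0..<T}"
proof -
  have step: "\<exists>e>0. t + e \<in> bounded_times" if t: "t \<in> bounded_times" for t
  proof -
    obtain M where "\<And>n. iter n t \<le> M" using t by (auto simp: bounded_times_def bdd_above_def)
    then obtain e where "e > 0" "\<And>n. iter n (t + e) \<le> M + 1"
      using iter_bound_step[of t M] t by (auto simp: bounded_times_def)
    then show ?thesis using t
      by (intro exI[of _ e]) (auto simp: bounded_times_def intro!: bdd_aboveI[of _ "M + 1"])
  qed
  have bdd: "bdd_above bounded_times"
  proof (rule ccontr)
    assume "\<not> bdd_above bounded_times"
    then have ex: "\<exists>b\<in>bounded_times. t < b" for t by (auto simp: bdd_above_def not_le)
    have "minsol t > 0" if "t > 0" for t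
    proof -
      obtain b where "b \<in> bounded_times" "t < b" using ex by blast
      then show ?thesis using minsol_ge[OF bounded_times_downward[of b t]] that u0 by simp
    qed
    then show False
      by (intro planar_flow_no_global[OF minsol_planar_flow[of "{0<..}"]]) (simp_all add: ex)
  qed
  define T where "T = Sup bounded_times"
  have le: "t \<le> T" if "t \<in> bounded_times" for t
    unfolding T_def by (rule cSup_upper[OF that bdd])
  have lt: "t < T" if "t \<in> bounded_times" for t
    using step[OF that] le by force
  have "t \<in> bounded_times" if t: "0 \<le> t" "t < T" for t
  proof -
    obtain b where "b \<in> bounded_times" "t < b"
    proof (rule less_cSupE)
      show "t < Sup bounded_times" using t(2) by (simp add: T_def)
      show "bounded_times \<noteq> {}" using bounded_times_0 by auto
    qed
    then show ?thesis
      by (rule bounded_times_downward[OF _ t(1) less_imp_le])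
  qed
  moreover have "t \<ge> 0" if "t \<in> bounded_times" for t using that by (simp add: bounded_times_def)
  ultimately have "bounded_times = {0..<T}" using lt by auto
  then show ?thesis using lt[OF bounded_times_0] by blast
qed

text \<open>Each iterate is continuous up to and including \<open>T\<close>. A bound
  \<open>Z\<close> on \<open>minsol\<close> before \<open>T\<close> would therefore carry over to
  all \<open>iter n T\<close> and put \<open>T\<close> into \<open>bounded_times\<close>.\<close>

lemma minsol_blows_up:
  assumes T: "T > 0" "bounded_times = {0..<T}"
  shows "filterlim minsol at_top (at_left T)"
  unfolding filterlim_at_top
proof
  fix Z
  have ex: "\<exists>s\<in>{0..<T}. Z \<le> minsol s"
  proof (rule ccontr)
    assume *: "\<not> ?thesis"
    have "iter n T \<le> Z" for n
    proof (rule tendsto_upperbound[OF _ _ trivial_limit_at_left_real])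
      have "(iter n \<longlongrightarrow> iter n T) (at T within {0..T})"
        using iter_continuous[of T n] T by (auto simp: continuous_on_def)
      then show "(iter n \<longlongrightarrow> iter n T) (at_left T)"
        using T(1) by (simp add: at_within_Icc_at_left)
      have "eventually (\<lambda>t. t \<in> {0<..<T}) (at_left T)"
        using T(1) by (rule eventually_at_left_real)
      then show "eventually (\<lambda>t. iter n t \<le> Z) (at_left T)"
      proof eventually_elim
        case (elim t)
        then have "t \<in> bounded_times" using T by simp
        then have "iter n t \<le> minsol t" by (rule iter_le_minsol)
        also have "minsol t \<le> Z" using * elim by (auto simp: not_le intro: less_imp_le)
        finally show ?case .
      qed
    qed
    then have "T \<in> bounded_times"
      using T(1) by (auto simp: bounded_times_def intro!: bdd_aboveI[of _ Z])
    then show False using T by simp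
  qed
  then obtain s where s: "s \<in> {0..<T}" "Z \<le> minsol s" by blast
  have "eventually (\<lambda>t. t \<in> {s<..<T}) (at_left T)"
    using s by (intro eventually_at_left_real) auto
  then show "eventually (\<lambda>t. Z \<le> minsol t) (at_left T)"
  proof eventually_elim
    case (elim t)
    then show ?case using s T minsol_nondecreasing[of t s] by auto
  qed
qed

end

section \<open>The delay equation\<close>

text \<open>A bound \<open>B\<close> for the history gives the integrable majorant
  \<open>B * exp (\<beta> * s)\<close>.\<close>

lemma set_integrable_exp_weighted:
  fixes \<phi> :: "real \<Rightarrow> real"
  assumes "\<beta> > 0" "continuous_on {..0} \<phi>" "bounded (\<phi> ` {..0})"
  shows "set_integrable lborel {..0} (\<lambda>s. exp (\<beta> * s) * \<phi> s)"
proof -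
  obtain B where B: "\<And>s. s \<le> 0 \<Longrightarrow> \<bar>\<phi> s\<bar> \<le> B"
    using assms(3) by (auto simp: bounded_iff)
  have "set_integrable lebesgue {0..} (\<lambda>x. exp (- \<beta> * x))"
    by (intro nonnegative_absolutely_integrable_1 integrable_on_exp_minus_to_infinity assms) simp
  then have "integrable lborel (\<lambda>x. indicator {0..} x *\<^sub>R exp (- \<beta> * x))"
    unfolding set_integrable_def by (subst (asm) integrable_completion) auto
  \<comment> \<open>The reflection of \<open>s\<close> to \<open>- s\<close> carries the exponential
    on \<open>{0..}\<close> to the one on \<open>{..0}\<close>.\<close>
  from lborel_integrable_real_affine[OF this, of "-1" 0]
  have "integrable lborel (\<lambda>x. indicator {..0} x *\<^sub>R exp (\<beta> * x))"
    by (rule back_subst[of "integrable lborel"]) (auto simp: indicator_def)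
  then have "set_integrable lborel {..0} (\<lambda>s. B * exp (\<beta> * s))"
    by (intro set_integrable_mult_right) (simp add: set_integrable_def)
  then show ?thesis
  proof (rule set_integrable_bound)
    show "set_borel_measurable lborel {..0} (\<lambda>s. exp (\<beta> * s) * \<phi> s)"
      using borel_measurable_continuous_on_indicator[of "{..0}" "\<lambda>s. exp (\<beta> * s) * \<phi> s"]
        continuous_on_mult[OF continuous_on_exp[OF continuous_on_mult_left[OF continuous_on_id]] assms(2)]
      by (simp add: set_borel_measurable_def)
    have "norm (exp (\<beta> * s) * \<phi> s) \<le> norm (B * exp (\<beta> * s))" if "s \<le> 0" for s
      using B[OF that] by (simp add: abs_mult mult.commute mult_right_mono)
    then show "AE s in lborel. s \<in> {..0} \<longrightarrow> norm (exp (\<beta> * s) * \<phi> s) \<le> norm (B * exp (\<beta> * s))"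
      by simp
  qed
qed

locale delay_ivp =
  fixes p \<alpha> \<beta> :: real and \<phi> :: "real \<Rightarrow> real"
  assumes p: "p > 1" and \<alpha>: "\<alpha> > 0" and \<beta>: "\<beta> > 0"
    and \<phi>_cont: "continuous_on {..0} \<phi>" and \<phi>_bounded: "bounded (\<phi> ` {..0})"
    and \<phi>_pos: "\<And>s. s \<le> 0 \<Longrightarrow> \<phi> s > 0"
begin

text \<open>\<open>\<alpha> * H\<close> is the delay integral at time 0, the initial value
  \<open>w0\<close> of the planar system.\<close>

definition H :: real where
  "H = (LBINT s:{..0}. exp (\<beta> * s) * \<phi> s)"

lemma H_pos: "H > 0"
proof -
  let ?f = "\<lambda>s. exp (\<beta> * s) * \<phi> s"
  have int: "set_integrable lborel {..0} ?f"
    by (rule set_integrable_exp_weighted[OF \<beta> \<phi>_cont \<phi>_bounded])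
  have c: "continuous_on {-1..0} ?f"
    by (intro continuous_intros continuous_on_subset[OF \<phi>_cont]) auto
  \<comment> \<open>A positive history may decay to 0 at minus infinity, so a positive minimum is
    taken on a compact interval; its length 1 makes the minimum itself a lower bound for the
    integral.\<close>
  obtain r where r: "r \<in> {-1..0}" "\<And>s. s \<in> {-1..0} \<Longrightarrow> ?f r \<le> ?f s"
    using continuous_attains_inf[OF compact_Icc _ c] by auto
  have "0 < ?f r" using r(1) \<phi>_pos[of r] by simp
  also have "?f r = integral {-1..0::real} (\<lambda>_. ?f r)" by simp
  also have "\<dots> \<le> integral {-1..0} ?f"
    by (intro integral_le integrable_continuous_interval c continuous_intros r) auto
  also have "\<dots> \<le> integral {..0} ?f"
    by (intro integral_subset_le set_borel_integral_eq_integral(1)[OF int] integrable_continuous_interval c)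
      (auto intro!: mult_nonneg_nonneg less_imp_le[OF \<phi>_pos])
  also have "\<dots> = H"
    unfolding H_def by (rule set_borel_integral_eq_integral(2)[OF int, symmetric])
  finally show ?thesis .
qed

sublocale delay_ode p \<alpha> \<beta> "\<phi> 0" "\<alpha> * H"
  by unfold_locales (use p \<alpha> \<beta> H_pos \<phi>_pos in auto)

text \<open>The factor \<open>exp (- \<beta> * t)\<close> leaves the integral, which splits at 0
  into the history part \<open>H\<close> and the part in \<open>W\<close>. The two ranges overlap in
  the null set \<open>{0}\<close>.\<close>

lemma memory_eq_W:
  assumes x: "\<And>s. s \<le> 0 \<Longrightarrow> x s = \<phi> s" and c: "continuous_on {0..t} x" and t: "t \<ge> 0"
  shows "(LBINT s:{..t}. \<alpha> * exp (- \<beta> * (t - s)) * x s) = W x t"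
proof -
  let ?f = "\<lambda>s. exp (\<beta> * s) * x s"
  have int0: "set_integrable lborel {..0} ?f"
    using set_integrable_exp_weighted[OF \<beta> \<phi>_cont \<phi>_bounded]
    by (rule set_integrable_cong[THEN iffD1, rotated -1]) (simp_all add: x)
  have int1: "set_integrable lborel {0..t} ?f"
    by (intro borel_integrable_atLeastAtMost' continuous_intros c)
  have "(LBINT s:{..t}. \<alpha> * exp (- \<beta> * (t - s)) * x s) = (LBINT s:{..t}. \<alpha> * exp (- \<beta> * t) * ?f s)"
    by (intro set_lebesgue_integral_cong) (auto simp: algebra_simps simp flip: exp_add)
  also have "\<dots> = \<alpha> * exp (- \<beta> * t) * (LBINT s:{..0} \<union> {0..t}. ?f s)"
  proof -
    have "{..0} \<union> {0..t} = {..t}" using t by auto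
    then show ?thesis by simp
  qed
  also have "(LBINT s:{..0} \<union> {0..t}. ?f s) = (LBINT s:{..0}. ?f s) + (LBINT s:{0..t}. ?f s)"
  proof (rule set_integral_Un_AE[OF _ _ _ int0 int1])
    show "AE s in lborel. \<not> (s \<in> {..0} \<and> s \<in> {0..t})"
      using AE_lborel_singleton[of "0::real"] by eventually_elim auto
  qed auto
  also have "(LBINT s:{..0}. ?f s) = H"
    unfolding H_def using x by (intro set_lebesgue_integral_cong) auto
  also have "(LBINT s:{0..t}. ?f s) = integral {0..t} ?f"
    by (rule set_borel_integral_eq_integral(2)[OF int1])
  finally show ?thesis by (simp add: W_def algebra_simps)
qed

text \<open>The equation holds only for positive times, so the fundamental theorem is used with
  derivatives in the interior and continuity at the end points.\<close>

lemma delay_solution_fixpoint: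
  assumes sol: "delay_solution p \<alpha> \<beta> \<phi> T x" and t: "0 \<le> t" "t < T"
  shows "x t = \<Phi> x t" "continuous_on {0..t} x"
proof -
  have c: "continuous_on {..<T} x" and x0: "\<And>s. s \<le> 0 \<Longrightarrow> x s = \<phi> s"
    and d: "\<And>s. 0 < s \<Longrightarrow> s < T \<Longrightarrow>
      (x has_real_derivative (LBINT r:{..s}. \<alpha> * exp (- \<beta> * (s - r)) * x r) powr p) (at s)"
    using sol by (auto simp: delay_solution_def)
  have c': "continuous_on {0..s} x" if "s < T" for s
    by (rule continuous_on_subset[OF c]) (use that in auto)
  then show "continuous_on {0..t} x" using t by blast
  have "((\<lambda>s. W x s powr p) has_integral (x t - x 0)) {0..t}"
  proof (rule fundamental_theorem_of_calculus_interior[OF t(1) c'[OF t(2)]])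
    fix s assume s: "s \<in> {0<..<t}"
    then have "(x has_real_derivative W x s powr p) (at s)"
      using d[of s] memory_eq_W[OF x0 c', of s] t by simp
    then show "(x has_vector_derivative W x s powr p) (at s)"
      by (simp add: has_real_derivative_iff_has_vector_derivative)
  qed
  then show "x t = \<Phi> x t" using x0[of 0] by (simp add: \<Phi>_def integral_unique)
qed

section \<open>The history joined to the minimal solution\<close>

definition sol :: "real \<Rightarrow> real" where
  "sol t = (if t \<le> 0 then \<phi> t else minsol t)"

lemma sol_eq_minsol: "t \<ge> 0 \<Longrightarrow> sol t = minsol t"
  using minsol_fixpoint(1)[OF bounded_times_0] by (auto simp: sol_def)

lemma W_sol: "W sol t = W minsol t"
proof -
  have "integral {0..t} (\<lambda>s. exp (\<beta> * s) * sol s) = integral {0..t} (\<lambda>s. exp (\<beta> * s) * minsol s)"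
    by (rule integral_cong) (simp add: sol_eq_minsol)
  then show ?thesis by (simp add: W_def)
qed

lemma minsol_flow: "bounded_times = {0..<T} \<Longrightarrow> planar_flow p \<alpha> \<beta> minsol (W minsol) {0<..<T}"
  by (rule minsol_planar_flow) (use dense in fastforce)+

lemma sol_deriv:
  assumes "bounded_times = {0..<T}" "0 < t" "t < T"
  shows "(sol has_real_derivative W minsol t powr p) (at t)"
proof (rule has_field_derivative_transform_within_open)
  show "(minsol has_real_derivative W minsol t powr p) (at t)"
    using planar_flow.u_deriv[OF minsol_flow[OF assms(1)]] assms by auto
qed (use assms in \<open>auto simp: sol_def intro: open_greaterThan[of 0]\<close>)

lemma sol_continuous:
  assumes "bounded_times = {0..<T}"
  shows "continuous_on {..<T} sol"
proof (rule continuous_at_imp_continuous_on, rule ballI)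
  fix t assume "t \<in> {..<T}"
  show "isCont sol t"
  proof (cases "T > 0")
    case True
    \<comment> \<open>A point strictly between \<open>max t 0\<close> and \<open>T\<close>, so that
      \<open>t\<close> is interior to \<open>{..b}\<close> and the two continuous pieces can be
      glued along 0.\<close>
    define b where "b = (max t 0 + T) / 2"
    have b: "0 \<le> b" "t < b" "b < T" using \<open>t \<in> {..<T}\<close> True by (simp_all add: b_def max_def)
    have "continuous_on ({..0} \<union> {0..b}) sol"
    proof (rule continuous_on_closed_Un)
      show "continuous_on {..0} sol"
        using \<phi>_cont by (rule continuous_on_eq) (simp add: sol_def)
      have "continuous_on {0..b} minsol"
        using b assms by (intro minsol_fixpoint) auto
      then show "continuous_on {0..b} sol"
        by (rule continuous_on_eq) (simp add: sol_eq_minsol)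
    qed auto
    moreover have "{..0} \<union> {0..b} = {..b}" using b by auto
    ultimately show ?thesis using b by (intro continuous_on_interior[of "{..b}"]) auto
  next
    case False
    then show ?thesis using bounded_times_0 assms by auto
  qed
qed

text \<open>Any solution \<open>x\<close> dominates all iterates, so its times are bounded times and
  \<open>T' \<le> T\<close>. It also dominates \<open>minsol\<close>, and ordered fixed points
  coincide.\<close>

lemma sol_the_delay_solution:
  assumes T: "T > 0" "bounded_times = {0..<T}"
  shows "the_delay_solution p \<alpha> \<beta> \<phi> T sol"
  unfolding the_delay_solution_def
proof (intro conjI allI impI)
  have "continuous_on {0..t} sol" if "t < T" for t
    by (rule continuous_on_subset[OF sol_continuous[OF T(2)]]) (use that in auto)
  then have "(LBINT s:{..t}. \<alpha> * exp (- \<beta> * (t - s)) * sol s) = W minsol t" if "0 < t" "t < T" for t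
    using memory_eq_W[of sol t] that by (simp add: sol_def W_sol)
  then show "delay_solution p \<alpha> \<beta> \<phi> T sol"
    unfolding delay_solution_def
    using T sol_continuous[OF T(2)] sol_deriv[OF T(2)] by (auto simp: sol_def)
next
  fix T' x assume x: "delay_solution p \<alpha> \<beta> \<phi> T' x"
  have le: "iter n t \<le> x t" if "0 \<le> t" "t < T'" for t n
    by (rule iter_le_fixpoint[of t]) (rule delay_solution_fixpoint[OF x], use that in auto)+
  have bt: "t \<in> bounded_times" if "0 \<le> t" "t < T'" for t
    using that le[OF that] by (auto simp: bounded_times_def intro!: bdd_aboveI[of _ "x t"])
  show "T' \<le> T"
    \<comment> \<open>If \<open>T < T'\<close>, then \<open>T\<close> itself would be a bounded
      time, but the interval is half-open.\<close>
    using bt[of T] T by (force simp: not_le)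
  fix t assume t: "t < T'"
  show "x t = sol t"
  proof (cases "t \<le> 0")
    case True
    then show ?thesis using x by (simp add: sol_def delay_solution_def)
  next
    case False
    have "minsol t = x t"
    proof (rule ordered_fixpoints_eq[of t minsol x])
      show "continuous_on {0..t} minsol" "\<And>s. s \<in> {0..t} \<Longrightarrow> minsol s = \<Phi> minsol s"
        by (rule minsol_fixpoint, rule bt, use t False in auto)+
      show "continuous_on {0..t} x" "\<And>s. s \<in> {0..t} \<Longrightarrow> x s = \<Phi> x s"
        by (rule delay_solution_fixpoint[OF x], use t False in auto)+
      show "minsol s \<le> x s" if "s \<in> {0..t}" for s
        using le that t by (intro LIMSEQ_le_const2[OF iter_tendsto_minsol[OF bt]]) auto
    qed (use False in auto)
    then show ?thesis using False by (simp add: sol_def)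
  qed
qed

end

theorem theorem1:
  fixes p \<alpha> \<beta> :: real and \<phi> :: "real \<Rightarrow> real"
  assumes "p > 1" and "\<alpha> > 0" and "\<beta> > 0"
    and "continuous_on {..0} \<phi>" and "bounded (\<phi> ` {..0})" and "\<forall>s\<le>0. \<phi> s > 0"
  shows "\<exists>T u. T > 0 \<and> the_delay_solution p \<alpha> \<beta> \<phi> T u \<and> blows_up_at u T \<and>
           (\<exists>A1 A2. A1 > 0 \<and> A2 > 0 \<and>
              u \<sim>[at_left T] (\<lambda>t. A1 * (T - t) powr (- ((p + 1) / (p - 1)))) \<and>
              deriv u \<sim>[at_left T] (\<lambda>t. A2 * (T - t) powr (- (2 * p / (p - 1)))))"
proof -
  interpret delay_ivp p \<alpha> \<beta> \<phi>
    by unfold_locales (use assms in auto)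
  obtain T where T: "T > 0" "bounded_times = {0..<T}" using bounded_times_eq by blast
  have ev: "eventually (\<lambda>t. t \<in> {0<..<T}) (at_left T)"
    using T(1) by (rule eventually_at_left_real)
  \<comment> \<open>\<open>sol\<close> and \<open>minsol\<close> agree only at nonnegative times,
    which suffices for asymptotics at \<open>T\<close>.\<close>
  have u: "eventually (\<lambda>t. minsol t = sol t) (at_left T)"
    using ev by eventually_elim (simp add: sol_eq_minsol)
  have u': "eventually (\<lambda>t. W minsol t powr p = deriv sol t) (at_left T)"
    using ev by eventually_elim (auto intro!: DERIV_imp_deriv[symmetric] sol_deriv[OF T(2)])
  obtain A1 A2 where A: "A1 > 0" "A2 > 0"
    "minsol \<sim>[at_left T] (\<lambda>t. A1 * (T - t) powr (- ((p + 1) / (p - 1))))"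
    "(\<lambda>t. W minsol t powr p) \<sim>[at_left T] (\<lambda>t. A2 * (T - t) powr (- (2 * p / (p - 1))))"
    using planar_flow_blowup_rate[OF minsol_flow[OF T(2)] T(1) minsol_blows_up[OF T]] by blast
  have "sol \<sim>[at_left T] (\<lambda>t. A1 * (T - t) powr (- ((p + 1) / (p - 1))))"
    "deriv sol \<sim>[at_left T] (\<lambda>t. A2 * (T - t) powr (- (2 * p / (p - 1))))"
    by (rule asymp_equiv_transfer[OF A(3) u] asymp_equiv_transfer[OF A(4) u']; simp)+
  moreover have "blows_up_at sol T"
    unfolding blows_up_at_def using minsol_blows_up[OF T] u
    by (simp add: filterlim_cong[OF refl refl u])
  ultimately show ?thesis
    using T(1) sol_the_delay_solution[OF T] A(1,2) by blast
qed

end
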